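(* Let $I\subseteq\mathbb{R}$ be an interval with interior $I^{\circ}$, let $f:I\to\mathbb{R}$ be differentiable on $I^{\circ}$, and let $a,b\in I^{\circ}$ with $a<b$ be such that $f'\in L[a,b]$. If $|f'|^{q}$ is convex on $[a,b]$ for some fixed $q\ge 1$, then for each $x\in[a,b]$, $$\left|\frac{(b-x)f(b)+(x-a)f(a)}{b-a}-\frac{1}{b-a}\int_a^b f(u)\,du\right|\le \frac12\left(\frac13\right)^{\frac1q}\left[\frac{(x-a)^2\left[|f'(x)|^q+2|f'(a)|^q\right]^{\frac1q}+(b-x)^2\left[|f'(x)|^q+2|f'(b)|^q\right]^{\frac1q}}{b-a}\right].$$
   Context: $f'\in L[a,b]$ means that $f'$ is (Lebesgue) integrable on $[a,b]$. *)

theory Defs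
  imports "HOL-Analysis.Analysis"
begin

end

theory Submission
  imports Defs
begin

text \<open>
  For an endpoint \<open>e\<close>, let \<open>F e\<close> be the mean of \<open>f\<close> over the segment from \<open>e\<close> to \<open>x\<close>.
  Integration by parts gives \<open>F e - f e = (x - e) \<integral>\<^sub>0\<^sup>1 (1 - t) f'(e + t (x - e)) dt\<close>.
  The power mean inequality for the weight \<open>1 - t\<close> is used in linearised form:
  \<open>\<bar>f'\<bar>\<^sup>q\<close> lies below its chord, and \<open>y powr (1/q)\<close> lies below its tangent at the weighted mean
  \<open>M\<close> of the chord, so \<open>\<bar>f'\<bar>\<close> is bounded by \<open>M powr (1/q)\<close> plus a multiple of \<open>t - 1/3\<close>,
  which integrates to zero against \<open>1 - t\<close>. The left-hand side of the theorem is a convex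
  combination of \<open>f e - F e\<close> for \<open>e = a, b\<close>.
\<close>

lemma powr_le_tangent:
  fixes p y m :: real
  assumes "0 < p" "p \<le> 1" "0 \<le> y" "0 < m"
  shows "y powr p \<le> m powr p + p * m powr (p - 1) * (y - m)"
proof (cases "y = 0")
  case True
  have "m powr (p - 1) * m = m powr p"
    using assms by (simp add: powr_diff)
  then have "m powr p + p * m powr (p - 1) * (y - m) = (1 - p) * m powr p"
    using True by (simp add: algebra_simps)
  then show ?thesis
    using True assms by simp
next
  case False
  have "y powr p = m powr p * (y / m) powr p"
    using assms by (simp add: powr_divide)
  also have "(y / m) powr p \<le> 1 + p * (y / m - 1)"
    using Youngs_inequality_0[of p "1 - p" "y / m" 1] assms False by (simp add: algebra_simps)
  also have "m powr p * (1 + p * (y / m - 1)) = m powr p + p * m powr (p - 1) * (y - m)"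
    using assms by (simp add: powr_diff field_simps)
  finally show ?thesis
    using assms by (simp add: mult_left_mono)
qed

text \<open>Under the probability density \<open>2 * (1 - t)\<close> on the unit interval,
  \<open>t\<close> has mean 1/3 and the chord from \<open>\<bar>\<phi> e\<bar> powr q\<close> to
  \<open>\<bar>\<phi> x\<bar> powr q\<close> has mean \<open>M\<close>. The slope \<open>c\<close>
  can stay unspecified because its term will integrate to zero.\<close>

lemma abs_le_of_powr_convex:
  fixes \<phi> :: "real \<Rightarrow> real" and q e x :: real
  defines "M \<equiv> (\<bar>\<phi> x\<bar> powr q + 2 * \<bar>\<phi> e\<bar> powr q) / 3"
  assumes q: "q \<ge> 1" and conv: "convex_on S (\<lambda>t. \<bar>\<phi> t\<bar> powr q)" and S: "e \<in> S" "x \<in> S"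
  obtains c where "\<And>t. 0 \<le> t \<Longrightarrow> t \<le> 1 \<Longrightarrow>
    \<bar>\<phi> (e + t * (x - e))\<bar> \<le> M powr (1 / q) + c * (t - 1 / 3)"
proof -
  define A B where "A = \<bar>\<phi> e\<bar> powr q" and "B = \<bar>\<phi> x\<bar> powr q"
  have nonneg: "0 \<le> A" "0 \<le> B" by (auto simp: A_def B_def)
  have M: "M = (B + 2 * A) / 3" by (simp add: M_def A_def B_def)
  have chord: "\<bar>\<phi> (e + t * (x - e))\<bar> \<le> ((1 - t) * A + t * B) powr (1 / q)" if "0 \<le> t" "t \<le> 1" for t
  proof -
    have "\<bar>\<phi> ((1 - t) *\<^sub>R e + t *\<^sub>R x)\<bar> powr q \<le> (1 - t) * A + t * B"
      using convex_onD[OF conv that S] by (simp add: A_def B_def)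
    also have "(1 - t) *\<^sub>R e + t *\<^sub>R x = e + t * (x - e)" by (simp add: algebra_simps)
    finally have "(\<bar>\<phi> (e + t * (x - e))\<bar> powr q) powr (1 / q) \<le> ((1 - t) * A + t * B) powr (1 / q)"
      using q by (intro powr_mono2) auto
    then show ?thesis using q by (simp add: powr_powr)
  qed
  show ?thesis
  \<comment> \<open>For \<open>q > 1\<close> the root has no tangent at 0; but \<open>M = 0\<close>
    forces both endpoint values, hence the chord, to vanish, and \<open>c = 0\<close> works.\<close>
  proof (cases "M = 0")
    case True
    then have "B + 2 * A = 0" using M by simp
    with nonneg have "A = 0" "B = 0" by linarith+
    with chord have "\<bar>\<phi> (e + t * (x - e))\<bar> \<le> M powr (1 / q) + 0 * (t - 1 / 3)"
      if "0 \<le> t" "t \<le> 1" for t using that True by fastforce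
    then show ?thesis using that by blast
  next
    case False
    then have "M > 0" using M nonneg by auto
    \<comment> \<open>Slope of the tangent to \<open>y powr (1 / q)\<close> at \<open>M\<close>,
      times the slope of the chord.\<close>
    define c where "c = 1 / q * M powr (1 / q - 1) * (B - A)"
    have "\<bar>\<phi> (e + t * (x - e))\<bar> \<le> M powr (1 / q) + c * (t - 1 / 3)" if t: "0 \<le> t" "t \<le> 1" for t
    proof -
      have "0 \<le> (1 - t) * A + t * B" using t nonneg by simp
      then have "((1 - t) * A + t * B) powr (1 / q)
          \<le> M powr (1 / q) + 1 / q * M powr (1 / q - 1) * ((1 - t) * A + t * B - M)"
        using powr_le_tangent[of "1 / q"] \<open>M > 0\<close> q by simp
      also have "(1 - t) * A + t * B - M = (B - A) * (t - 1 / 3)"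
        by (simp add: M field_simps)
      finally show ?thesis using chord[OF t] by (simp add: c_def mult.assoc)
    qed
    then show ?thesis using that by blast
  qed
qed

text \<open>Parametrising the segment by the unit interval lets \<open>e\<close> lie on either side
  of \<open>x\<close>, or equal it, so one argument serves both endpoints.\<close>

lemma abs_segment_mean_minus_endpoint_le:
  fixes f f' :: "real \<Rightarrow> real" and q e x :: real
  assumes deriv: "\<And>t. t \<in> closed_segment e x \<Longrightarrow> (f has_real_derivative f' t) (at t)"
    and q: "q \<ge> 1" and conv: "convex_on S (\<lambda>t. \<bar>f' t\<bar> powr q)" and S: "e \<in> S" "x \<in> S"
  shows "\<bar>integral {0..1} (\<lambda>t. f (e + t * (x - e))) - f e\<bar>
    \<le> \<bar>x - e\<bar> / 2 * ((\<bar>f' x\<bar> powr q + 2 * \<bar>f' e\<bar> powr q) / 3) powr (1 / q)"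
proof -
  define R where "R = ((\<bar>f' x\<bar> powr q + 2 * \<bar>f' e\<bar> powr q) / 3) powr (1 / q)"
  obtain c where c: "\<And>t. 0 \<le> t \<Longrightarrow> t \<le> 1 \<Longrightarrow> \<bar>f' (e + t * (x - e))\<bar> \<le> R + c * (t - 1 / 3)"
    using abs_le_of_powr_convex[OF q conv S] unfolding R_def by blast
  have seg: "e + t * (x - e) \<in> closed_segment e x" if "t \<in> {0..1}" for t
    using that by (auto simp: closed_segment_def algebra_simps intro!: exI[of _ t])
  define \<psi> where "\<psi> t = (1 - t) * ((x - e) * f' (e + t * (x - e)))" for t
  have D: "((\<lambda>t. f (e + t * (x - e))) has_real_derivative (x - e) * f' (e + t * (x - e)))
      (at t within {0..1})" if "t \<in> {0..1}" for t
  proof -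
    have "((\<lambda>t. e + t * (x - e)) has_real_derivative (x - e)) (at t within {0..1})"
      by (auto intro!: derivative_eq_intros)
    from DERIV_chain2[where f = f, OF deriv[OF seg[OF that]] this] show ?thesis
      by (simp add: mult.commute)
  qed
  have "continuous_on {0..1} (\<lambda>t. f (e + t * (x - e)))"
    using D by (rule DERIV_continuous_on)
  then have int: "((\<lambda>t. f (e + t * (x - e))) has_integral
      integral {0..1} (\<lambda>t. f (e + t * (x - e)))) {0..1}"
    by (intro integrable_integral integrable_continuous_real)
  \<comment> \<open>Integration by parts: the factor \<open>t - 1\<close> vanishes at
    \<open>t = 1\<close>, so only the boundary value \<open>f e\<close> at \<open>t = 0\<close>
    survives.\<close>
  have parts: "((\<lambda>t. (t - 1) * f (e + t * (x - e))) has_real_derivative f (e + t * (x - e)) - \<psi> t)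
      (at t within {0..1})" if "t \<in> {0..1}" for t
  proof -
    have "((\<lambda>t. t - 1) has_real_derivative 1) (at t within {0..1})"
      by (auto intro!: derivative_eq_intros)
    from DERIV_mult[OF this D[OF that]] show ?thesis
      by (simp add: \<psi>_def algebra_simps)
  qed
  have "((\<lambda>t. f (e + t * (x - e)) - \<psi> t) has_integral
      (1 - 1) * f (e + 1 * (x - e)) - (0 - 1) * f (e + 0 * (x - e))) {0..1}"
    by (rule fundamental_theorem_of_calculus[OF zero_le_one
          parts[unfolded has_real_derivative_iff_has_vector_derivative]])
  \<comment> \<open>The subtraction yields both the integrability of \<open>\<psi>\<close> and the
    value of its integral.\<close>
  from has_integral_diff[OF int this]
  have \<psi>: "(\<psi> has_integral integral {0..1} (\<lambda>t. f (e + t * (x - e))) - f e) {0..1}"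
    by simp
  \<comment> \<open>An antiderivative of the majorant of \<open>\<bar>\<psi>\<bar>\<close>; the
    cubic multiplying \<open>c\<close> is zero at both 0 and 1.\<close>
  define G where "G t = \<bar>x - e\<bar> * (R * (t - t\<^sup>2 / 2) + c * (2 / 3 * t\<^sup>2 - t / 3 - t ^ 3 / 3))" for t
  have G: "((\<lambda>t. (1 - t) * (\<bar>x - e\<bar> * (R + c * (t - 1 / 3)))) has_integral G 1 - G 0) {0..1}"
    by (rule fundamental_theorem_of_calculus)
       (auto simp: G_def has_real_derivative_iff_has_vector_derivative[symmetric] field_simps
          power2_eq_square intro!: derivative_eq_intros)
  have le: "norm (\<psi> t) \<le> (1 - t) * (\<bar>x - e\<bar> * (R + c * (t - 1 / 3)))" if "t \<in> {0..1}" for t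
    using c[of t] that by (auto simp: \<psi>_def abs_mult intro!: mult_left_mono)
  have "norm (integral {0..1} \<psi>) \<le> G 1 - G 0"
    using integral_norm_bound_integral[OF has_integral_integrable[OF \<psi>] has_integral_integrable[OF G] le]
    unfolding integral_unique[OF G] .
  also have "G 1 - G 0 = \<bar>x - e\<bar> / 2 * R"
    by (simp add: G_def)
  finally show ?thesis
    using \<psi> by (simp add: has_integral_iff R_def)
qed

text \<open>An integral over a reversed interval is 0, so the left-hand side is the oriented
  integral from \<open>e\<close> to \<open>x\<close>, and the substitution
  \<open>e + t * (x - e)\<close> applies in either direction.\<close>

lemma integral_segment_eq:
  fixes f :: "real \<Rightarrow> real"
  assumes "continuous_on (closed_segment e x) f"
  shows "integral {e..x} f - integral {x..e} f
    = (x - e) * integral {0..1} (\<lambda>t. f (e + t * (x - e)))"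
proof -
  have "((\<lambda>t. (x - e) *\<^sub>R f (e + t * (x - e))) has_integral
      integral {e + 0 * (x - e)..e + 1 * (x - e)} f - integral {e + 1 * (x - e)..e + 0 * (x - e)} f) {0..1}"
  proof (rule has_integral_substitution_general[where s = "{}" and c = "min e x" and d = "max e x"])
    have "closed_segment e x = {min e x..max e x}"
      by (auto simp: closed_segment_eq_real_ivl)
    then show "continuous_on {min e x..max e x} f" using assms by simp
    have "e + t * (x - e) \<in> closed_segment e x" if "t \<in> {0..1}" for t
      using that by (auto simp: closed_segment_def algebra_simps intro!: exI[of _ t])
    then show "(\<lambda>t. e + t * (x - e)) ` {0..1} \<subseteq> {min e x..max e x}"
      using \<open>closed_segment e x = _\<close> by blast
  qed (auto intro!: continuous_intros derivative_eq_intros)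
  then show ?thesis
    by (simp add: has_integral_iff)
qed

theorem theorem6:
  fixes I :: "real set" and f :: "real \<Rightarrow> real" and a b q x :: real
  assumes "is_interval I"
    and "\<And>t. t \<in> interior I \<Longrightarrow> f differentiable (at t)"
    and "a \<in> interior I" and "b \<in> interior I" and "a < b"
    and "set_integrable lebesgue {a..b} (deriv f)"
    and "q \<ge> 1"
    and "convex_on {a..b} (\<lambda>t. \<bar>deriv f t\<bar> powr q)"
    and "x \<in> {a..b}"
  shows "\<bar>((b - x) * f b + (x - a) * f a) / (b - a) - 1 / (b - a) * integral {a..b} f\<bar>
    \<le> 1 / 2 * (1 / 3) powr (1 / q) *
      (((x - a)\<^sup>2 * (\<bar>deriv f x\<bar> powr q + 2 * \<bar>deriv f a\<bar> powr q) powr (1 / q)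
        + (b - x)\<^sup>2 * (\<bar>deriv f x\<bar> powr q + 2 * \<bar>deriv f b\<bar> powr q) powr (1 / q)) / (b - a))"
proof -
  have "convex (interior I)"
    using assms(1) by (simp add: is_interval_convex convex_interior)
  then have "{a..b} \<subseteq> interior I"
    using assms(3-5) closed_segment_subset[of a "interior I" b] by (simp add: closed_segment_eq_real_ivl)
  then have D: "(f has_real_derivative deriv f t) (at t)" if "t \<in> {a..b}" for t
    using assms(2) that by (auto simp: DERIV_deriv_iff_real_differentiable)
  then have cont: "continuous_on {a..b} f"
    by (meson DERIV_continuous_on has_field_derivative_at_within)
  define F where "F e = integral {0..1} (\<lambda>t. f (e + t * (x - e)))" for e
  define K where "K e = (\<bar>deriv f x\<bar> powr q + 2 * \<bar>deriv f e\<bar> powr q) powr (1 / q)" for e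
  \<comment> \<open>The divisor 3 of the weighted mean, taken out of the power.\<close>
  define T where "T = (1 / 3 :: real) powr (1 / q)"
  have seg: "closed_segment e x \<subseteq> {a..b}" if "e \<in> {a..b}" for e
    using assms(9) that by (auto simp: closed_segment_eq_real_ivl split: if_splits)
  have bound: "\<bar>f e - F e\<bar> \<le> \<bar>x - e\<bar> / 2 * (T * K e)" if "e \<in> {a..b}" for e
  proof -
    have "\<bar>F e - f e\<bar> \<le> \<bar>x - e\<bar> / 2 * ((\<bar>deriv f x\<bar> powr q + 2 * \<bar>deriv f e\<bar> powr q) / 3) powr (1 / q)"
      unfolding F_def using D seg[OF that] assms(7-9) that
      by (intro abs_segment_mean_minus_endpoint_le) auto
    then show ?thesis
      by (simp add: T_def K_def powr_divide abs_minus_commute)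
  qed
  have sub: "integral {e..x} f - integral {x..e} f = (x - e) * F e" if "e \<in> {a..b}" for e
    unfolding F_def by (rule integral_segment_eq[OF continuous_on_subset[OF cont seg[OF that]]])
  have ax: "integral {a..x} f = (x - a) * F a"
    using sub[of a] assms(5,9) by (cases "x = a") auto
  have xb: "integral {x..b} f = (b - x) * F b"
    using sub[of b] assms(5,9) by (cases "x = b") (auto simp: algebra_simps)
  \<comment> \<open>The weights of the two means are those of \<open>f a\<close> and
    \<open>f b\<close> in the claim, so the difference regroups into the two endpoint
    errors.\<close>
  have "integral {a..b} f = (x - a) * F a + (b - x) * F b"
    using Henstock_Kurzweil_Integration.integral_combine[of a x b f] ax xb assms(9)
      integrable_continuous_real[OF cont] by simp
  then have "\<bar>(b - x) * f b + (x - a) * f a - integral {a..b} f\<bar>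
      = \<bar>(b - x) * (f b - F b) + (x - a) * (f a - F a)\<bar>"
    by (simp add: algebra_simps)
  also have "\<dots> \<le> (b - x) * \<bar>f b - F b\<bar> + (x - a) * \<bar>f a - F a\<bar>"
    using assms(9) by (intro order.trans[OF abs_triangle_ineq]) (simp add: abs_mult)
  \<comment> \<open>The length in each error bound meets the equal weight in front, which produces
    the squares.\<close>
  also have "\<dots> \<le> (b - x) * (\<bar>x - b\<bar> / 2 * (T * K b)) + (x - a) * (\<bar>x - a\<bar> / 2 * (T * K a))"
    using assms(5,9) by (intro add_mono mult_left_mono bound) auto
  also have "\<dots> = 1 / 2 * T * ((x - a)\<^sup>2 * K a + (b - x)\<^sup>2 * K b)"
    using assms(9) by (simp add: power2_eq_square field_simps)
  finally have "\<bar>(b - x) * f b + (x - a) * f a - integral {a..b} f\<bar> / (b - a)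
      \<le> 1 / 2 * T * ((x - a)\<^sup>2 * K a + (b - x)\<^sup>2 * K b) / (b - a)"
    using assms(5) by (intro divide_right_mono) auto
  moreover have "\<bar>((b - x) * f b + (x - a) * f a) / (b - a) - 1 / (b - a) * integral {a..b} f\<bar>
      = \<bar>(b - x) * f b + (x - a) * f a - integral {a..b} f\<bar> / (b - a)"
    using assms(5) by (simp add: diff_divide_distrib[symmetric])
  ultimately show ?thesis
    by (simp add: T_def K_def)
qed

end
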